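(* In the setting and notation of the context, assume $\mathcal{P}>0$. Let $$\gamma_P=\frac{c\,h}{d\,\alpha+1},\qquad \gamma_E=\frac{c\,f}{d\,\varphi+1},$$ let $C_{\text{sec}}=B\log_2(1+\gamma_P)-B\log_2(1+\gamma_E)$ if $\gamma_P\ge\gamma_E$ and $C_{\text{sec}}=0$ if $\gamma_P<\gamma_E$, and let $P_{\text{ex}}=\Pr\{C_{\text{sec}}>0\}=\Pr\{\gamma_P>\gamma_E\}$. Put $$A_0=\frac{d\,\Omega_\alpha}{c\,\Omega_h},\quad B_0=c\,\Omega_h,\quad D_0=\frac{d\,\Omega_\varphi}{c\,\Omega_f},\quad E_0=c\,\Omega_f,\quad \frac1{C_0}=\frac1{B_0}+\frac1{E_0}.$$ Then: (i) if $A_0=D_0$, $$P_{\text{ex}}=\frac{C_0D_0-1}{2C_0D_0}+\frac{1}{D_0E_0}+\frac{1}{2C_0^2D_0^2}\exp\left(\frac1{C_0D_0}\right)\Gamma\left[0,\frac1{C_0D_0}\right]+\frac{1}{C_0D_0^2E_0}\exp\left(\frac1{C_0D_0}\right)\mathrm{Ei}\left(-\frac1{C_0D_0}\right);$$ (ii) if $A_0\ne D_0$, $$\begin{aligned}P_{\text{ex}}=&\frac{A_0D_0}{(D_0-A_0)^2}\left\{\exp\left(\frac1{A_0C_0}\right)\Gamma\left[0,\frac1{A_0C_0}\right]-\exp\left(\frac1{C_0D_0}\right)\Gamma\left[0,\frac1{C_0D_0}\right]\right\}\\&+\frac{D_0}{D_0-A_0}+\frac{1}{C_0(D_0-A_0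)}\exp\left(\frac1{C_0D_0}\right)\mathrm{Ei}\left(-\frac1{C_0D_0}\right)\\&+\frac{1}{E_0(A_0-D_0)}\left\{\exp\left(\frac1{A_0C_0}\right)\Gamma\left[0,\frac1{A_0C_0}\right]-\exp\left(\frac1{C_0D_0}\right)\Gamma\left[0,\frac1{C_0D_0}\right]\right\}.\end{aligned}$$
   Context: $P_p,N_0,B,r_p,P_{\text{pk}}>0$ and $\theta_{th}\in(0,1)$ are constants (primary transmit power, noise power, bandwidth, primary target rate, secondary peak power, primary outage threshold). The channel power gains $h$ (primary transmitter to primary receiver), $\alpha$ (secondary transmitter to primary receiver), $f$ (primary transmitter to eavesdropper), $\varphi$ (secondary transmitter to eavesdropper) are mutually independent exponential random variables with means $\Omega_h,\Omega_\alpha,\Omega_f,\Omega_\varphi>0$. The secondary transmitter uses the deterministic power $$\mathcal{P}=\min\left\{\frac{P_p\Omega_h}{\gamma_{th}\Omega_\alpha}\chi^{+},P_{\text{pk}}\right\},\quad \gamma_{th}=2^{r_p/B}-1,\quad \chi^{+}=\max\left\{\frac{1}{1-\theta_{th}}\exp\left(-\frac{N_0\gamma_{th}}{P_p\Omega_h}\right)-1,0\right\}.$$ Set $c=P_p/N_0$ and $d=\mathcal{P}/N_0$. $\gamma_P$ and $\gamma_E$ are the signal-to-interference-plus-noise ratios at the primary receiver and the eavesdropper, $C_{\text{sec}}$ is the secrecy capacity of the primary user, and $P_{\text{ex}}$ is the probability of existence of a non-zero secrecy capacity. For $z>0$, $\Gamma[0,z]=\int_z^\infty \frac{e^{-t}}{t}\,dt$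 (incomplete gamma function) and $\mathrm{Ei}(-z)=-\Gamma[0,z]$ (exponential integral). *)

theory Defs
  imports "HOL-Probability.Probability"
begin

text \<open>The function \<open>\<Gamma>[0,z]\<close>, meant for \<open>z > 0\<close>.\<close>

definition inc_Gamma0 :: "real \<Rightarrow> real" where
  "inc_Gamma0 z = (LBINT t:{z..}. exp (- t) / t)"

text \<open>The exponential integral, meant for negative arguments only.\<close>

definition Ei :: "real \<Rightarrow> real" where
  "Ei x = - inc_Gamma0 (- x)"

definition sinr_threshold :: "real \<Rightarrow> real \<Rightarrow> real" where
  "sinr_threshold r_p B = 2 powr (r_p / B) - 1"

definition chi_plus :: "real \<Rightarrow> real \<Rightarrow> real \<Rightarrow> real \<Rightarrow> real \<Rightarrow> real" where
  "chi_plus P_p N_0 \<gamma>_th \<theta>_th \<Omega>_h =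
     max (1 / (1 - \<theta>_th) * exp (- (N_0 * \<gamma>_th) / (P_p * \<Omega>_h)) - 1) 0"

definition secondary_power ::
  "real \<Rightarrow> real \<Rightarrow> real \<Rightarrow> real \<Rightarrow> real \<Rightarrow> real \<Rightarrow> real \<Rightarrow> real \<Rightarrow> real" where
  "secondary_power P_p N_0 B r_p P_pk \<theta>_th \<Omega>_h \<Omega>_\<alpha> =
     (let \<gamma>_th = sinr_threshold r_p B in
      min (P_p * \<Omega>_h / (\<gamma>_th * \<Omega>_\<alpha>) * chi_plus P_p N_0 \<gamma>_th \<theta>_th \<Omega>_h) P_pk)"

definition sinr :: "real \<Rightarrow> real \<Rightarrow> real \<Rightarrow> real \<Rightarrow> real" where
  "sinr c d signal_gain interference_gain = c * signal_gain / (d * interference_gain + 1)"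

definition secrecy_capacity :: "real \<Rightarrow> real \<Rightarrow> real \<Rightarrow> real" where
  "secrecy_capacity B \<gamma>_P \<gamma>_E =
     (if \<gamma>_P \<ge> \<gamma>_E then B * log 2 (1 + \<gamma>_P) - B * log 2 (1 + \<gamma>_E) else 0)"

end

(* Conditioning on the interference, each SINR has the tail exp (- x / E) / (1 + D x). The two SINRs
   are independent, so the probability is the integral of the tail of gamma_P against the density of
   gamma_E, obtained by differentiating its tail. Partial fractions reduce this to the integrals of
   exp (- l x) / (1 + D x)^n over x >= 0 for n <= 3; integration by parts lowers n, and n = 1 is an
   incomplete Gamma function after an affine substitution. *)
theory Submission
  imports Defs
begin

section \<open>Comparing independent variables, and the Laplace transform of an exponential
  variable\<close>

text \<open>Independence makes the joint law a product measure, and Tonelli evaluates the half-plane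
  above the diagonal by its sections. The right side is again an expectation over \<open>M\<close>,
  so a tail formula for \<open>X\<close> need only hold at almost every value of
  \<open>Y\<close>.\<close>

lemma (in prob_space) prob_less_indep_var:
  fixes X Y :: "'a \<Rightarrow> real"
  assumes ind: "indep_var borel Y borel X"
  shows "\<P>(\<omega> in M. Y \<omega> < X \<omega>) = (\<integral>\<omega>. \<P>(\<omega>' in M. Y \<omega> < X \<omega>') \<partial>M)"
proof -
  have rv[measurable]: "random_variable borel X" "random_variable borel Y"
    using indep_var_rv1[OF ind] indep_var_rv2[OF ind] by auto
  have pair: "distr M borel Y \<Otimes>\<^sub>M distr M borel X =
      distr M (borel \<Otimes>\<^sub>M borel) (\<lambda>\<omega>. (Y \<omega>, X \<omega>))"
    using ind by (simp add: indep_var_distribution_eq)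
  interpret DX: prob_space "distr M borel X" by (rule prob_space_distr) simp
  let ?A = "{p :: real \<times> real. fst p < snd p}"
  have A: "?A \<in> sets (borel \<Otimes>\<^sub>M borel)"
    by (subst borel_prod) (intro borel_open open_Collect_less continuous_intros)
  have S: "emeasure (distr M borel X) (Pair y -` ?A) = ennreal (\<P>(\<omega>' in M. y < X \<omega>'))" for y
    by (subst emeasure_distr)
      (auto simp: emeasure_eq_measure vimage_def Int_def conj_commute intro!: arg_cong[where f = prob])
  have [measurable]: "(\<lambda>y. \<P>(\<omega>' in M. y < X \<omega>')) \<in> borel_measurable borel"
    by measurable
  have "ennreal (\<P>(\<omega> in M. Y \<omega> < X \<omega>)) = emeasure (distr M borel Y \<Otimes>\<^sub>M distr M borel X) ?A"
    unfolding pair using A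
    by (subst emeasure_distr)
      (auto simp: emeasure_eq_measure vimage_def Int_def conj_commute intro!: arg_cong[where f = prob])
  also have "\<dots> = (\<integral>\<^sup>+y. ennreal (\<P>(\<omega>' in M. y < X \<omega>')) \<partial>distr M borel Y)"
  proof -
    have "?A \<in> sets (distr M borel Y \<Otimes>\<^sub>M distr M borel X)"
      using A by (simp cong: sets_pair_measure_cong)
    then show ?thesis
      by (simp only: DX.emeasure_pair_measure_alt S)
  qed
  also have "\<dots> = (\<integral>\<^sup>+\<omega>. ennreal (\<P>(\<omega>' in M. Y \<omega> < X \<omega>')) \<partial>M)"
    by (subst nn_integral_distr) auto
  also have "\<dots> = ennreal (\<integral>\<omega>. \<P>(\<omega>' in M. Y \<omega> < X \<omega>') \<partial>M)"
    by (intro nn_integral_eq_integral integrable_const_bound[where B = 1]) auto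
  finally show ?thesis
    by (simp add: integral_nonneg_AE)
qed

lemma (in prob_space) AE_exponential_nonneg:
  assumes "distributed M lborel X (exponential_density l)"
  shows "AE \<omega> in M. 0 \<le> X \<omega>"
  by (subst distributed_AE2[OF assms]) (auto simp: exponential_density_def)

text \<open>Exponential tilting: multiplying the density of rate \<open>l\<close> by
  \<open>exp (- s * x)\<close> gives \<open>l / (l + s)\<close> times the density of rate
  \<open>l + s\<close>, whose total mass is 1.\<close>

lemma (in prob_space) expectation_exp_exponential:
  assumes X: "distributed M lborel X (exponential_density l)" and "0 < l" "0 \<le> s"
  shows "(\<integral>\<omega>. exp (- s * X \<omega>) \<partial>M) = l / (l + s)"
proof -
  interpret E: prob_space "density lborel (exponential_density (l + s))"
    using assms by (intro prob_space_exponential_density) auto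
  have "(\<integral>\<omega>. exp (- s * X \<omega>) \<partial>M) = (\<integral>x. exponential_density l x * exp (- s * x) \<partial>lborel)"
    using assms by (subst distributed_integral[OF X]) (auto simp: exponential_density_nonneg)
  also have "\<dots> = (\<integral>x. l / (l + s) * exponential_density (l + s) x \<partial>lborel)"
  proof (intro Bochner_Integration.integral_cong refl)
    fix x
    have "exp (- x * (l + s)) = exp (- x * l) * exp (- s * x)"
      by (simp add: algebra_simps flip: exp_add)
    then show "exponential_density l x * exp (- s * x) = l / (l + s) * exponential_density (l + s) x"
      using assms by (simp add: exponential_density_def)
  qed
  also have "\<dots> = l / (l + s) * (\<integral>x. 1 \<partial>density lborel (exponential_density (l + s)))"
    using assms by (subst integral_real_density) (auto simp: exponential_density_nonneg)
  finally show ?thesis by (simp add: E.prob_space[simplified])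
qed

section \<open>Tail and density of an SINR, and the comparison of two of them\<close>

text \<open>The SINR exceeds \<open>x\<close> when the signal gain exceeds
  \<open>x / c * (d * Z + 1)\<close>. The exponential tail of \<open>X\<close> at this level is the
  exponential of an affine function of \<open>Z\<close>, and the Laplace transform of
  \<open>Z\<close> yields the rational factor.\<close>

lemma (in prob_space) sinr_tail:
  assumes X: "distributed M lborel X (exponential_density (1 / \<Omega>))"
    and Z: "distributed M lborel Z (exponential_density (1 / \<Omega>'))"
    and ind: "indep_var borel Z borel X"
    and pos: "0 < \<Omega>" "0 < \<Omega>'" "0 < c" "0 \<le> d" and x: "0 \<le> x"
  shows "\<P>(\<omega> in M. x < sinr c d (X \<omega>) (Z \<omega>)) =
    exp (- x / (c * \<Omega>)) / (1 + d * \<Omega>' / (c * \<Omega>) * x)"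
proof -
  let ?Y = "\<lambda>\<omega>. x / c * (d * Z \<omega> + 1)"
  have [measurable]: "random_variable borel X" "random_variable borel Z"
    using indep_var_rv1[OF ind] indep_var_rv2[OF ind] by auto
  have iY: "indep_var borel ?Y borel X"
    by (rule indep_var_compose[OF ind, of "\<lambda>z. x / c * (d * z + 1)" borel "\<lambda>x. x" borel,
          unfolded comp_def]) measurable
  have "\<P>(\<omega> in M. x < sinr c d (X \<omega>) (Z \<omega>)) = \<P>(\<omega> in M. ?Y \<omega> < X \<omega>)"
  proof (rule finite_measure_eq_AE)
    \<comment> \<open>The two events agree only almost everywhere: clearing the denominator uses
      \<open>Z\<close> nonnegative.\<close>
    show "AE \<omega> in M. \<omega> \<in> {\<omega> \<in> space M. x < sinr c d (X \<omega>) (Z \<omega>)} \<longleftrightarrow> \<omega> \<in> {\<omega> \<in> space M. ?Y \<omega> < X \<omega>}"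
      using AE_exponential_nonneg[OF Z]
    proof eventually_elim
      case (elim \<omega>)
      then have "0 < d * Z \<omega> + 1" using pos by (intro add_nonneg_pos) auto
      then show ?case using pos by (simp add: sinr_def field_simps)
    qed
  qed (auto simp: sinr_def)
  also have "\<dots> = (\<integral>\<omega>. \<P>(\<omega>' in M. ?Y \<omega> < X \<omega>') \<partial>M)"
    by (rule prob_less_indep_var[OF iY])
  also have "\<dots> = (\<integral>\<omega>. exp (- x / (c * \<Omega>)) * exp (- (x * d / (c * \<Omega>)) * Z \<omega>) \<partial>M)"
  proof (rule integral_cong_AE)
    show "AE \<omega> in M. \<P>(\<omega>' in M. ?Y \<omega> < X \<omega>') = exp (- x / (c * \<Omega>)) * exp (- (x * d / (c * \<Omega>)) * Z \<omega>)"
      using AE_exponential_nonneg[OF Z]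
    proof eventually_elim
      case (elim \<omega>)
      \<comment> \<open>The exponential tail formula holds only at nonnegative levels.\<close>
      then have "0 \<le> ?Y \<omega>" using pos x by (intro mult_nonneg_nonneg) auto
      from exponential_distributedD_gt[OF X this] pos show ?case
        by (simp add: field_simps flip: exp_add)
    qed
  qed measurable
  also have "\<dots> = exp (- x / (c * \<Omega>)) * (1 / \<Omega>' / (1 / \<Omega>' + x * d / (c * \<Omega>)))"
    using pos x by (simp only: integral_mult_right_zero) (subst expectation_exp_exponential[OF Z], auto)
  also have "1 / \<Omega>' / (1 / \<Omega>' + x * d / (c * \<Omega>)) = 1 / (1 + d * \<Omega>' / (c * \<Omega>) * x)"
    using pos x by (simp add: field_simps)
  finally show ?thesis by simp
qed

text \<open>The density is minus the derivative of the tail. It is verified through the distribution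
  function, using the fundamental theorem of calculus on \<open>{0..a}\<close>.\<close>

lemma (in prob_space) distributed_sinr:
  assumes X: "distributed M lborel X (exponential_density (1 / \<Omega>))"
    and Z: "distributed M lborel Z (exponential_density (1 / \<Omega>'))"
    and ind: "indep_var borel Z borel X"
    and pos: "0 < \<Omega>" "0 < \<Omega>'" "0 < c" "0 \<le> d"
    and E: "E = c * \<Omega>" and D: "D = d * \<Omega>' / (c * \<Omega>)"
  shows "distributed M lborel (\<lambda>\<omega>. sinr c d (X \<omega>) (Z \<omega>))
    (\<lambda>x::real. if x < 0 then 0 else exp (- x / E) * (1 / (E * (1 + D * x)) + D / (1 + D * x)\<^sup>2))"
    (is "distributed M lborel ?Y (\<lambda>x::real. ennreal (?g x))")
proof -
  let ?f = "\<lambda>x::real. exp (- x / E) * (1 / (E * (1 + D * x)) + D / (1 + D * x)\<^sup>2)"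
  \<comment> \<open>Minus the tail, so that \<open>1 + ?G a\<close> is the distribution function for
    nonnegative \<open>a\<close>; in particular \<open>?G 0 = - 1\<close>.\<close>
  let ?G = "\<lambda>x::real. - (exp (- x / E) / (1 + D * x))"
  have [measurable]: "random_variable borel X" "random_variable borel Z"
    using indep_var_rv1[OF ind] indep_var_rv2[OF ind] by auto
  have Y[measurable]: "random_variable borel ?Y"
    by (simp add: sinr_def)
  have E0: "0 < E" and D0: "0 \<le> D" using pos by (auto simp: E D)
  have nonneg: "0 \<le> ?f x" if "0 \<le> x" for x
    using that E0 D0 by (intro mult_nonneg_nonneg add_nonneg_nonneg divide_nonneg_nonneg) auto
  have le: "\<P>(\<omega> in M. ?Y \<omega> \<le> a) = 1 + ?G a" if "0 \<le> a" for a
  proof -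
    have "\<P>(\<omega> in M. ?Y \<omega> \<le> a) = 1 - \<P>(\<omega> in M. a < ?Y \<omega>)"
      by (subst prob_neg[symmetric]) (auto simp: not_less)
    then show ?thesis
      using sinr_tail[OF X Z ind pos that] by (simp add: E D)
  qed
  have G: "(\<integral>\<^sup>+x. ennreal (?g x * indicator {..a} x) \<partial>lborel) = ennreal (1 + ?G a)"
    if a: "0 \<le> a" for a
  proof -
    have "(\<integral>\<^sup>+x. ennreal (?g x * indicator {..a} x) \<partial>lborel) =
        (\<integral>\<^sup>+x. ennreal (?f x) * indicator {0..a} x \<partial>lborel)"
      by (intro nn_integral_cong) (auto split: split_indicator)
    also have "\<dots> = ennreal (?G a - ?G 0)"
    proof (rule nn_integral_FTC_Icc)
      fix x :: real assume "x \<in> {0..a}"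
      then have x: "0 \<le> x" by simp
      then have "1 + D * x \<noteq> 0" using D0 by (smt (verit) mult_nonneg_nonneg)
      \<comment> \<open>Writing reciprocals with \<open>inverse\<close> leaves an identity
        polynomial in them.\<close>
      then have "((\<lambda>x. - (exp (- x / E) * inverse (1 + D * x))) has_real_derivative
          exp (- x / E) * (inverse E * inverse (1 + D * x) + D * (inverse (1 + D * x))\<^sup>2)) (at x)"
        using E0 by (auto intro!: derivative_eq_intros simp: algebra_simps power2_eq_square inverse_eq_divide[of E])
      then show "(?G has_real_derivative ?f x) (at x)"
        by (simp add: divide_inverse power_inverse)
    qed (use nonneg a in auto)
    finally show ?thesis by simp
  qed
  show ?thesis
  proof (rule distributedI_borel_atMost[where g = "\<lambda>a. if a < 0 then 0 else 1 + ?G a"])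
    show "AE x in lborel. 0 \<le> ?g x"
      using nonneg by auto
    show "(\<integral>\<^sup>+x. ennreal (?g x * indicator {..a} x) \<partial>lborel) = ennreal (if a < 0 then 0 else 1 + ?G a)" for a
    proof (cases "a < 0")
      case True
      then show ?thesis
        by (subst nn_integral_cong[where v = "\<lambda>_. 0"]) (auto split: split_indicator)
    qed (use G in auto)
    show "emeasure M {\<omega> \<in> space M. ?Y \<omega> \<le> a} = ennreal (if a < 0 then 0 else 1 + ?G a)" for a
    proof (cases "a < 0")
      case True
      \<comment> \<open>The tail formula says nothing about negative \<open>a\<close>; monotonicity
        bounds the distribution function there by its value at 0, which is 0.\<close>
      have "\<P>(\<omega> in M. ?Y \<omega> \<le> a) \<le> \<P>(\<omega> in M. ?Y \<omega> \<le> 0)"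
        using True by (intro finite_measure_mono) auto
      also have "\<dots> = 0" using le[of 0] by simp
      finally show ?thesis
        using True by (simp add: emeasure_eq_measure measure_le_0_iff)
    qed (use le in \<open>auto simp: emeasure_eq_measure\<close>)
  qed measurable
qed

text \<open>The tail of the larger SINR is integrated against the density of the smaller one. Their
  exponential factors merge into a single one, whose rate \<open>l\<close> is the sum of the two
  rates.\<close>

lemma (in prob_space) prob_sinr_less:
  assumes X: "distributed M lborel X (exponential_density (1 / \<Omega>\<^sub>X))"
    and Z: "distributed M lborel Z (exponential_density (1 / \<Omega>\<^sub>Z))"
    and ZX: "indep_var borel Z borel X"
    and U: "distributed M lborel U (exponential_density (1 / \<Omega>\<^sub>U))"
    and V: "distributed M lborel V (exponential_density (1 / \<Omega>\<^sub>V))"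
    and VU: "indep_var borel V borel U"
    and ind: "indep_var borel (\<lambda>\<omega>. sinr c d (U \<omega>) (V \<omega>)) borel (\<lambda>\<omega>. sinr c d (X \<omega>) (Z \<omega>))"
    and pos: "0 < \<Omega>\<^sub>X" "0 < \<Omega>\<^sub>Z" "0 < \<Omega>\<^sub>U" "0 < \<Omega>\<^sub>V" "0 < c" "0 \<le> d"
    and A: "A = d * \<Omega>\<^sub>Z / (c * \<Omega>\<^sub>X)" and D: "D = d * \<Omega>\<^sub>V / (c * \<Omega>\<^sub>U)" and E: "E = c * \<Omega>\<^sub>U"
    and l: "l = 1 / (c * \<Omega>\<^sub>X) + 1 / E"
  shows "\<P>(\<omega> in M. sinr c d (U \<omega>) (V \<omega>) < sinr c d (X \<omega>) (Z \<omega>)) =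
    (LBINT x:{0..}. exp (- l * x) / (1 + A * x) * (1 / (E * (1 + D * x)) + D / (1 + D * x)\<^sup>2))"
proof -
  let ?Y = "\<lambda>\<omega>. sinr c d (U \<omega>) (V \<omega>)"
  let ?S = "\<lambda>x. exp (- x / (c * \<Omega>\<^sub>X)) / (1 + A * x)"
  let ?g = "\<lambda>x. exp (- x / E) * (1 / (E * (1 + D * x)) + D / (1 + D * x)\<^sup>2)"
  have [measurable]: "random_variable borel ?Y" "random_variable borel (\<lambda>\<omega>. sinr c d (X \<omega>) (Z \<omega>))"
    using indep_var_rv1[OF ind] indep_var_rv2[OF ind] by auto
  have E0: "0 < E" and D0: "0 \<le> D" using pos by (auto simp: E D)
  have dY: "distributed M lborel ?Y (\<lambda>x. if x < 0 then 0 else ?g x)"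
    using distributed_sinr[OF U V VU _ _ _ _ E D] pos by simp
  \<comment> \<open>Needed because \<open>sinr_tail\<close> covers nonnegative thresholds
    only.\<close>
  have Ynonneg: "AE \<omega> in M. 0 \<le> ?Y \<omega>"
    using AE_exponential_nonneg[OF U] AE_exponential_nonneg[OF V]
    by eventually_elim (use pos in \<open>auto simp: sinr_def\<close>)
  have "\<P>(\<omega> in M. ?Y \<omega> < sinr c d (X \<omega>) (Z \<omega>)) =
      (\<integral>\<omega>. \<P>(\<omega>' in M. ?Y \<omega> < sinr c d (X \<omega>') (Z \<omega>')) \<partial>M)"
    by (rule prob_less_indep_var[OF ind])
  also have "\<dots> = (\<integral>\<omega>. ?S (?Y \<omega>) \<partial>M)"
  proof (rule integral_cong_AE)
    show "AE \<omega> in M. \<P>(\<omega>' in M. ?Y \<omega> < sinr c d (X \<omega>') (Z \<omega>')) = ?S (?Y \<omega>)"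
      using Ynonneg by eventually_elim (use pos in \<open>simp add: sinr_tail[OF X Z ZX] A\<close>)
  qed measurable
  also have "\<dots> = (\<integral>x. (if x < 0 then 0 else ?g x) * ?S x \<partial>lborel)"
  proof (rule distributed_integral[OF dY, symmetric])
    show "0 \<le> (if x < 0 then 0 else ?g x)" for x
      using E0 D0 by (auto intro!: mult_nonneg_nonneg add_nonneg_nonneg divide_nonneg_nonneg)
  qed measurable
  also have "\<dots> = (LBINT x:{0..}. exp (- l * x) / (1 + A * x) *
      (1 / (E * (1 + D * x)) + D / (1 + D * x)\<^sup>2))"
    unfolding set_lebesgue_integral_def
  proof (intro Bochner_Integration.integral_cong refl)
    fix x
    have "exp (- l * x) = exp (- x / (c * \<Omega>\<^sub>X)) * exp (- x / E)"
      by (simp add: l algebra_simps flip: exp_add)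
    then show "(if x < 0 then 0 else ?g x) * ?S x = indicator {0..} x *\<^sub>R
        (exp (- l * x) / (1 + A * x) * (1 / (E * (1 + D * x)) + D / (1 + D * x)\<^sup>2))"
      by (simp add: indicator_def)
  qed
  finally show ?thesis .
qed

section \<open>Integrals of a decaying exponential over powers of an affine function\<close>

text \<open>For positive \<open>l\<close> and \<open>D\<close> this is
  \<open>exp (l / D) / D\<close> times the generalized exponential integral of order
  \<open>n\<close> at \<open>l / D\<close>, by the substitution
  \<open>t = 1 + D * x\<close>.\<close>

definition exp_frac_integral :: "real \<Rightarrow> real \<Rightarrow> nat \<Rightarrow> real" where
  "exp_frac_integral l D n = (\<integral>x. indicator {0..} x * (exp (- l * x) / (1 + D * x) ^ n) \<partial>lborel)"

text \<open>The denominator is at least 1 on the half-line, so \<open>exp (- l * x)\<close>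
  dominates. Carrying integrability and value together lets linear combinations be integrated by
  introduction rules alone.\<close>

lemma has_bochner_integral_exp_frac:
  fixes l D :: real
  assumes "0 < l" "0 \<le> D"
  shows "has_bochner_integral lborel (\<lambda>x. indicator {0..} x * (exp (- l * x) / (1 + D * x) ^ n))
    (exp_frac_integral l D n)"
  unfolding exp_frac_integral_def
proof (rule has_bochner_integral_integrable, rule Bochner_Integration.integrable_bound)
  show "integrable lborel (\<lambda>x. indicator {0..} x * exp (- l * x))"
  proof (rule integrableI_nn_integral_finite)
    have lim: "((\<lambda>x. - exp (- l * x) / l) \<longlongrightarrow> 0) at_top"
      using assms by real_asymp
    have "(\<integral>\<^sup>+x. ennreal (indicator {0..} x * exp (- l * x)) \<partial>lborel) =
        (\<integral>\<^sup>+x. ennreal (exp (- l * x)) * indicator {0..} x \<partial>lborel)"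
      by (intro nn_integral_cong) (auto simp: indicator_def)
    also have "\<dots> = ennreal (0 - (- exp (- l * 0) / l))"
      using assms by (intro nn_integral_FTC_atLeast lim) (auto intro!: derivative_eq_intros)
    finally show "(\<integral>\<^sup>+x. ennreal (indicator {0..} x * exp (- l * x)) \<partial>lborel) =
        ennreal (0 - (- exp (- l * 0) / l))" .
  qed auto
  show "AE x in lborel. norm (indicator {0..} x * (exp (- l * x) / (1 + D * x) ^ n))
      \<le> norm (indicator {0..} x * exp (- l * x))"
  proof (rule AE_I2)
    fix x :: real
    show "norm (indicator {0..} x * (exp (- l * x) / (1 + D * x) ^ n)) \<le>
        norm (indicator {0..} x * exp (- l * x))"
    proof (cases "0 \<le> x")
      case True
      then have "1 \<le> (1 + D * x) ^ n"
        using assms by (intro one_le_power) auto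
      then show ?thesis
        using True by (simp add: divide_le_eq)
    qed simp
  qed
qed auto

text \<open>Integration by parts: the left side integrates the derivative of
  \<open>- exp (- l * x) / (1 + D * x) ^ n\<close>, which runs from -1 at 0 to 0 at infinity. The
  unsolved form also covers \<open>n = 0\<close> and \<open>D = 0\<close>.\<close>

lemma exp_frac_integral_Suc:
  assumes "0 < l" "0 \<le> D"
  shows "l * exp_frac_integral l D n + n * D * exp_frac_integral l D (Suc n) = 1"
proof -
  let ?F = "\<lambda>n x. indicator {0..} x * (exp (- l * x) / (1 + D * x) ^ n)"
  let ?f = "\<lambda>x. l * (exp (- l * x) / (1 + D * x) ^ n) + n * D * (exp (- l * x) / (1 + D * x) ^ Suc n)"
  have "has_bochner_integral lborel (\<lambda>x. l * ?F n x + n * D * ?F (Suc n) x)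
      (l * exp_frac_integral l D n + n * D * exp_frac_integral l D (Suc n))"
    by (intro has_bochner_integral_add has_bochner_integral_mult_right
        has_bochner_integral_exp_frac assms)
  \<comment> \<open>The same function is integrated a second time, now through its antiderivative;
    uniqueness of the integral gives the recursion.\<close>
  moreover have "has_bochner_integral lborel (\<lambda>x. l * ?F n x + n * D * ?F (Suc n) x) 1"
  proof (rule has_bochner_integral_nn_integral)
    show "AE x in lborel. 0 \<le> l * ?F n x + n * D * ?F (Suc n) x"
      using assms by (intro AE_I2) (auto simp: indicator_def intro!: mult_nonneg_nonneg add_nonneg_nonneg)
    have lim: "((\<lambda>x. - exp (- l * x) / (1 + D * x) ^ n) \<longlongrightarrow> 0) at_top"
    proof (rule Lim_null_comparison)
      show "((\<lambda>x. exp (- l * x)) \<longlongrightarrow> 0) at_top"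
        using assms by real_asymp
      show "\<forall>\<^sub>F x in at_top. norm (- exp (- l * x) / (1 + D * x) ^ n) \<le> exp (- l * x)"
        using eventually_ge_at_top[of 0]
      proof eventually_elim
        case (elim x)
        then have "1 \<le> (1 + D * x) ^ n"
          using assms by (intro one_le_power) auto
        then show ?case
          by (simp add: divide_le_eq)
      qed
    qed
    have "(\<integral>\<^sup>+x. ennreal (l * ?F n x + n * D * ?F (Suc n) x) \<partial>lborel) =
        (\<integral>\<^sup>+x. ennreal (?f x) * indicator {0..} x \<partial>lborel)"
      by (intro nn_integral_cong) (auto simp: indicator_def)
    also have "\<dots> = ennreal (0 - (- exp (- l * 0) / (1 + D * 0) ^ n))"
    proof (rule nn_integral_FTC_atLeast[OF _ _ _ lim])
      fix x :: real assume x: "0 \<le> x"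
      then have "0 < 1 + D * x" using assms by (intro add_pos_nonneg) auto
      then have "((\<lambda>x. - exp (- l * x) * inverse (1 + D * x) ^ n) has_real_derivative
          l * (exp (- l * x) * inverse (1 + D * x) ^ n) +
          n * D * (exp (- l * x) * inverse (1 + D * x) ^ Suc n)) (at x)"
        \<comment> \<open>The power rule produces the exponent \<open>n - 1\<close>, truncated at
          \<open>n = 0\<close>, hence the case split.\<close>
        by (auto intro!: derivative_eq_intros) (cases n; simp add: algebra_simps)
      then show "((\<lambda>x. - exp (- l * x) / (1 + D * x) ^ n) has_real_derivative ?f x) (at x)"
        by (simp only: divide_inverse power_inverse)
      show "0 \<le> ?f x" using assms x by (auto intro!: mult_nonneg_nonneg add_nonneg_nonneg)
    qed auto
    finally show "(\<integral>\<^sup>+x. ennreal (l * ?F n x + n * D * ?F (Suc n) x) \<partial>lborel) = ennreal 1"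
      by simp
  qed auto
  ultimately show ?thesis
    by (rule has_bochner_integral_eq)
qed

text \<open>Substituting \<open>t = l / D + l * x\<close>, which equals
  \<open>l / D * (1 + D * x)\<close>, maps the half-line from 0 onto the one from
  \<open>l / D\<close>.\<close>

lemma exp_frac_integral_1:
  assumes "0 < l" "0 < D"
  shows "exp_frac_integral l D 1 = exp (l / D) * inc_Gamma0 (l / D) / D"
proof -
  have eq: "indicator {l / D..} (l / D + l * x) *\<^sub>R (exp (- (l / D + l * x)) / (l / D + l * x)) =
      exp (- (l / D)) * D / l * (indicator {0..} x * (exp (- l * x) / (1 + D * x) ^ 1))" for x
  proof -
    have "l / D + l * x = l / D * (1 + D * x)"
      using assms by (simp add: field_simps)
    moreover have "exp (- (l / D + l * x)) = exp (- (l / D)) * exp (- l * x)"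
      by (simp flip: exp_add)
    moreover have "indicator {l / D..} (l / D + l * x) = (indicator {0..} x :: real)"
      using assms by (simp add: indicator_def zero_le_mult_iff)
    ultimately show ?thesis
      by (simp only: real_scaleR_def) simp
  qed
  have "inc_Gamma0 (l / D) = \<bar>l\<bar> *\<^sub>R (\<integral>x. indicator {l / D..} (l / D + l * x) *\<^sub>R
      (exp (- (l / D + l * x)) / (l / D + l * x)) \<partial>lborel)"
    unfolding inc_Gamma0_def set_lebesgue_integral_def
    using assms by (subst lborel_integral_real_affine[of l _ "l / D"]) auto
  also have "\<dots> = exp (- (l / D)) * D * exp_frac_integral l D 1"
    using assms by (simp only: eq integral_mult_right_zero exp_frac_integral_def) simp
  finally show ?thesis
    using assms by (simp add: exp_minus field_simps)
qed

section \<open>Closed forms of the probability integral\<close>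

text \<open>With equal coefficients the integrand is already a combination of the powers 2 and 3,
  and the recursion brings both down to power 1.\<close>

lemma integral_exp_frac_equal:
  fixes l D E :: real
  assumes l: "0 < l" and D: "0 < D"
  defines "K \<equiv> exp (l / D) * inc_Gamma0 (l / D)"
  shows "(LBINT x:{0..}. exp (- l * x) / (1 + D * x) * (1 / (E * (1 + D * x)) + D / (1 + D * x)\<^sup>2)) =
    (1 - l / D * K) / (D * E) + (1 - l / D + (l / D)\<^sup>2 * K) / 2"
proof -
  let ?F = "\<lambda>n x. indicator {0..} x * (exp (- l * x) / (1 + D * x) ^ n)"
  let ?J = "exp_frac_integral l D"
  have J1: "?J 1 = K / D"
    using exp_frac_integral_1[OF l D] by (simp add: K_def)
  have J2: "?J 2 = (1 - l / D * K) / D"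
  proof -
    have "D * ?J 2 = 1 - l * ?J 1"
      using exp_frac_integral_Suc[of l D 1] l D by (simp add: numeral_2_eq_2)
    then show ?thesis
      using D unfolding J1 by (simp add: field_simps)
  qed
  have J3: "?J 3 = (1 - l / D + (l / D)\<^sup>2 * K) / (2 * D)"
  proof -
    have "2 * D * ?J 3 = 1 - l * ?J 2"
      using exp_frac_integral_Suc[of l D 2] l D by (simp add: numeral_3_eq_3)
    then have J3: "?J 3 = (1 - l * ?J 2) / (2 * D)"
      using D by (simp add: field_simps)
    show ?thesis
      unfolding J3 J2 using D by (simp add: field_simps power2_eq_square)
  qed
  have "(LBINT x:{0..}. exp (- l * x) / (1 + D * x) * (1 / (E * (1 + D * x)) + D / (1 + D * x)\<^sup>2)) =
      (\<integral>x. 1 / E * ?F 2 x + D * ?F 3 x \<partial>lborel)"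
    unfolding set_lebesgue_integral_def
    by (intro Bochner_Integration.integral_cong refl)
      (simp only: real_scaleR_def divide_inverse inverse_mult_distrib power_inverse[symmetric],
        simp add: power2_eq_square power3_eq_cube distrib_left mult_ac)
  also have "\<dots> = 1 / E * ?J 2 + D * ?J 3"
    by (intro has_bochner_integral_integral_eq has_bochner_integral_add
        has_bochner_integral_mult_right has_bochner_integral_exp_frac) (use l D in auto)
  also have "\<dots> = (1 - l / D * K) / (D * E) + (1 - l / D + (l / D)\<^sup>2 * K) / 2"
    unfolding J2 J3 using D by simp
  finally show ?thesis .
qed

text \<open>The rational factor has a simple pole at \<open>- 1 / A\<close> and a double pole at
  \<open>- 1 / D\<close>, so partial fractions leave only powers 1 and 2.\<close>

lemma integral_exp_frac_distinct:
  fixes l A D E :: real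
  assumes l: "0 < l" and A: "0 < A" and D: "0 < D" and ne: "A \<noteq> D"
  defines "K \<equiv> \<lambda>D. exp (l / D) * inc_Gamma0 (l / D)"
  shows "(LBINT x:{0..}. exp (- l * x) / (1 + A * x) * (1 / (E * (1 + D * x)) + D / (1 + D * x)\<^sup>2)) =
    (K A - K D) / (E * (A - D)) + (D - l * K D) / (D - A) + A * D / (D - A)\<^sup>2 * (K A - K D)"
proof -
  let ?F = "\<lambda>D n x. indicator {0..} x * (exp (- l * x) / (1 + D * x) ^ n)"
  let ?J = "exp_frac_integral l"
  have J1: "?J D 1 = K D / D" if "0 < D" for D
    using exp_frac_integral_1[OF l that] by (simp add: K_def)
  have J2: "?J D 2 = (1 - l / D * K D) / D"
  proof -
    have "D * ?J D 2 = 1 - l * ?J D 1"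
      using exp_frac_integral_Suc[of l D 1] l D by (simp add: numeral_2_eq_2)
    then show ?thesis
      using D unfolding J1[OF D] by (simp add: field_simps)
  qed
  \<comment> \<open>Coefficients of the two simple fractions, found by applying the splitting of
    \<open>p * q\<close> below once to the \<open>1 / E\<close> term and twice to the
    \<open>D\<close> term.\<close>
  let ?a = "- A / (E * (D - A)) + A\<^sup>2 * D / (D - A)\<^sup>2"
  let ?b = "D / (E * (D - A)) - A * D\<^sup>2 / (D - A)\<^sup>2"
  have pf: "1 / (1 + A * x) * (1 / (E * (1 + D * x)) + D / (1 + D * x)\<^sup>2) =
      ?a * (1 / (1 + A * x)) + ?b * (1 / (1 + D * x)) + D\<^sup>2 / (D - A) * (1 / (1 + D * x)\<^sup>2)"
    if x: "0 \<le> x" for x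
  proof -
    \<comment> \<open>With the reciprocals as atoms, the decomposition becomes a polynomial
      identity.\<close>
    define p q r where "p = inverse (1 + A * x)" and "q = inverse (1 + D * x)"
      and "r = inverse (D - A)"
    have "1 + A * x \<noteq> 0" "1 + D * x \<noteq> 0"
      using x A D by (smt (verit) mult_nonneg_nonneg)+
    \<comment> \<open>Over the common denominator the numerator is
      \<open>D * (1 + A * x) - A * (1 + D * x)\<close>, and \<open>x\<close> cancels.\<close>
    then have "D * q - A * p = (D - A) * (p * q)"
      by (simp add: p_def q_def field_simps)
    then have pq: "p * q = (D * q - A * p) / (D - A)"
      using ne by simp
    have "p * q\<^sup>2 = (D * q\<^sup>2 - A * (p * q)) / (D - A)"
      using ne arg_cong[OF pq, of "\<lambda>t. t * q"] by (simp add: power2_eq_square field_simps)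
    then have pqq: "p * q\<^sup>2 = D / (D - A) * q\<^sup>2 - A / (D - A) * ((D * q - A * p) / (D - A))"
      unfolding pq by (simp add: diff_divide_distrib)
    have "1 / (1 + A * x) * (1 / (E * (1 + D * x)) + D / (1 + D * x)\<^sup>2) = inverse E * (p * q) + D * (p * q\<^sup>2)"
      by (simp only: p_def q_def divide_inverse inverse_mult_distrib power_inverse[symmetric])
        (simp add: distrib_left mult_ac)
    also have "\<dots> = ?a * p + ?b * q + D\<^sup>2 / (D - A) * q\<^sup>2"
      unfolding pq pqq
      by (simp only: divide_inverse inverse_mult_distrib power_inverse[symmetric] r_def[symmetric])
        (simp add: power2_eq_square algebra_simps)
    finally show ?thesis
      by (simp add: p_def q_def divide_inverse power_inverse)
  qed
  have "(LBINT x:{0..}. exp (- l * x) / (1 + A * x) * (1 / (E * (1 + D * x)) + D / (1 + D * x)\<^sup>2)) =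
      (\<integral>x. (?a * ?F A 1 x + ?b * ?F D 1 x) + D\<^sup>2 / (D - A) * ?F D 2 x \<partial>lborel)"
    unfolding set_lebesgue_integral_def
  proof (intro Bochner_Integration.integral_cong refl)
    fix x
    show "indicator {0..} x *\<^sub>R (exp (- l * x) / (1 + A * x) * (1 / (E * (1 + D * x)) + D / (1 + D * x)\<^sup>2)) =
        (?a * ?F A 1 x + ?b * ?F D 1 x) + D\<^sup>2 / (D - A) * ?F D 2 x"
    proof (cases "0 \<le> x")
      case True
      from arg_cong[OF pf[OF this], of "\<lambda>t. exp (- l * x) * t"] show ?thesis
        using True by (simp only: ring_distribs) (simp add: mult_ac)
    qed simp
  qed
  also have "\<dots> = (?a * ?J A 1 + ?b * ?J D 1) + D\<^sup>2 / (D - A) * ?J D 2"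
    by (intro has_bochner_integral_integral_eq has_bochner_integral_add
        has_bochner_integral_mult_right has_bochner_integral_exp_frac) (use l A D in auto)
  also have "?a * ?J A 1 = - K A / (E * (D - A)) + A * D / (D - A)\<^sup>2 * K A"
    unfolding J1[OF A] using A by (simp only: distrib_right) (simp add: power2_eq_square)
  also have "?b * ?J D 1 = K D / (E * (D - A)) - A * D / (D - A)\<^sup>2 * K D"
    unfolding J1[OF D] using D by (simp only: left_diff_distrib) (simp add: power2_eq_square)
  also have "D\<^sup>2 / (D - A) * ?J D 2 = (D - l * K D) / (D - A)"
    unfolding J2 using D by (simp add: power2_eq_square right_diff_distrib diff_divide_distrib)
  \<comment> \<open>The result has \<open>A - D\<close> in this denominator, hence the two sign
    changes.\<close>
  also have "K D / (E * (D - A)) = - K D / (E * (A - D))"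
    by (metis minus_diff_eq minus_divide_divide mult_minus_right)
  also have "- K A / (E * (D - A)) = K A / (E * (A - D))"
    by (metis minus_diff_eq minus_divide_divide mult_minus_right minus_minus)
  finally show ?thesis
    by (simp add: diff_divide_distrib right_diff_distrib)
qed

section \<open>Secrecy capacity and the final formulas\<close>

text \<open>The logarithm is strictly increasing on the positive reals, where \<open>1 + x\<close>
  and \<open>1 + y\<close> lie; a tie gives capacity 0.\<close>

lemma secrecy_capacity_pos_iff:
  assumes "0 < B" "0 \<le> x" "0 \<le> y"
  shows "0 < secrecy_capacity B x y \<longleftrightarrow> y < x"
  using assms by (auto simp: secrecy_capacity_def)

(* exponential_density takes the rate, i.e. the reciprocal of the mean. *)
theorem mainTheorem3:
  fixes M :: "'a measure"
    and h \<alpha> f \<phi> \<gamma>_P \<gamma>_E C_sec :: "'a \<Rightarrow> real"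
    and P_p N_0 B r_p P_pk \<theta>_th \<Omega>_h \<Omega>_\<alpha> \<Omega>_f \<Omega>_\<phi> :: real
    and \<P> c d P_ex A0 B0 C0 D0 E0 :: real
  assumes "prob_space M"
    and "P_p > 0" "N_0 > 0" "B > 0" "r_p > 0" "P_pk > 0"
    and "0 < \<theta>_th" "\<theta>_th < 1"
    and "\<Omega>_h > 0" "\<Omega>_\<alpha> > 0" "\<Omega>_f > 0" "\<Omega>_\<phi> > 0"
    and "distributed M lborel h (exponential_density (1 / \<Omega>_h))"
    and "distributed M lborel \<alpha> (exponential_density (1 / \<Omega>_\<alpha>))"
    and "distributed M lborel f (exponential_density (1 / \<Omega>_f))"
    and "distributed M lborel \<phi> (exponential_density (1 / \<Omega>_\<phi>))"
    and "prob_space.indep_vars M (\<lambda>_. borel) (\<lambda>i. [h, \<alpha>, f, \<phi>] ! i) {..<4}"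
    and "\<P> = secondary_power P_p N_0 B r_p P_pk \<theta>_th \<Omega>_h \<Omega>_\<alpha>"
    and "\<P> > 0"
    and "c = P_p / N_0"
    and "d = \<P> / N_0"
    and "\<gamma>_P = (\<lambda>\<omega>. sinr c d (h \<omega>) (\<alpha> \<omega>))"
    and "\<gamma>_E = (\<lambda>\<omega>. sinr c d (f \<omega>) (\<phi> \<omega>))"
    and "C_sec = (\<lambda>\<omega>. secrecy_capacity B (\<gamma>_P \<omega>) (\<gamma>_E \<omega>))"
    and "P_ex = \<P>(\<omega> in M. C_sec \<omega> > 0)"
    and "A0 = d * \<Omega>_\<alpha> / (c * \<Omega>_h)"
    and "B0 = c * \<Omega>_h"
    and "D0 = d * \<Omega>_\<phi> / (c * \<Omega>_f)"
    and "E0 = c * \<Omega>_f"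
    and "1 / C0 = 1 / B0 + 1 / E0"
  shows "P_ex = \<P>(\<omega> in M. \<gamma>_P \<omega> > \<gamma>_E \<omega>)
    \<and> (A0 = D0 \<longrightarrow>
        P_ex = (C0 * D0 - 1) / (2 * C0 * D0) + 1 / (D0 * E0)
          + 1 / (2 * C0\<^sup>2 * D0\<^sup>2) * exp (1 / (C0 * D0)) * inc_Gamma0 (1 / (C0 * D0))
          + 1 / (C0 * D0\<^sup>2 * E0) * exp (1 / (C0 * D0)) * Ei (- (1 / (C0 * D0))))
    \<and> (A0 \<noteq> D0 \<longrightarrow>
        P_ex = A0 * D0 / (D0 - A0)\<^sup>2
            * (exp (1 / (A0 * C0)) * inc_Gamma0 (1 / (A0 * C0))
               - exp (1 / (C0 * D0)) * inc_Gamma0 (1 / (C0 * D0)))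
          + D0 / (D0 - A0)
          + 1 / (C0 * (D0 - A0)) * exp (1 / (C0 * D0)) * Ei (- (1 / (C0 * D0)))
          + 1 / (E0 * (A0 - D0))
            * (exp (1 / (A0 * C0)) * inc_Gamma0 (1 / (A0 * C0))
               - exp (1 / (C0 * D0)) * inc_Gamma0 (1 / (C0 * D0))))"
proof -
  interpret prob_space M by fact
  note X = assms(13-16)
  note pos = assms(2,3,9-12)
  have [measurable]: "random_variable borel h" "random_variable borel \<alpha>"
      "random_variable borel f" "random_variable borel \<phi>"
    using X[THEN distributed_measurable] by auto
  have c0: "0 < c" and d0: "0 < d"
    using assms by auto
  let ?X = "\<lambda>i. [h, \<alpha>, f, \<phi>] ! i"
  \<comment> \<open>Functions of disjoint blocks of the four gains are independent. This serves both
    for the gains inside each SINR and for the two SINRs against each other.\<close>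
  have indep: "indep_var borel (\<lambda>\<omega>. u (\<lambda>i\<in>P. ?X i \<omega>)) borel (\<lambda>\<omega>. v (\<lambda>i\<in>Q. ?X i \<omega>))"
    if "P \<inter> Q = {}" "P \<subseteq> {..<4}" "Q \<subseteq> {..<4}"
      "u \<in> borel_measurable (PiM P (\<lambda>_. borel))" "v \<in> borel_measurable (PiM Q (\<lambda>_. borel))"
    for P Q :: "nat set" and u v :: "(nat \<Rightarrow> real) \<Rightarrow> real"
    using indep_var_compose[OF indep_var_restrict[OF assms(17) that(1-3)] that(4,5)]
    by (simp add: comp_def)
  have i_P: "indep_var borel \<alpha> borel h"
    using indep[of "{1}" "{0}" "\<lambda>g. g 1" "\<lambda>g. g 0"] by simp
  have i_E: "indep_var borel \<phi> borel f"
    using indep[of "{3}" "{2}" "\<lambda>g. g 3" "\<lambda>g. g 2"] by (simp add: numeral_2_eq_2 numeral_3_eq_3)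
  have i_PE: "indep_var borel \<gamma>_E borel \<gamma>_P"
    using indep[of "{2, 3}" "{0, 1}" "\<lambda>g. sinr c d (g 2) (g 3)" "\<lambda>g. sinr c d (g 0) (g 1)"]
    by (simp add: sinr_def assms(22,23) numeral_2_eq_2 numeral_3_eq_3)
  have [measurable]: "random_variable borel \<gamma>_P" "random_variable borel \<gamma>_E"
    by (simp_all add: assms(22,23) sinr_def)
  \<comment> \<open>Exponential gains are nonnegative only almost surely, so the two events are
    compared up to a null set.\<close>
  have "AE \<omega> in M. 0 < C_sec \<omega> \<longleftrightarrow> \<gamma>_E \<omega> < \<gamma>_P \<omega>"
    using X[THEN AE_exponential_nonneg]
  proof eventually_elim
    case (elim \<omega>)
    then have "0 \<le> \<gamma>_P \<omega>" "0 \<le> \<gamma>_E \<omega>"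
      using c0 d0 by (auto simp: assms(22,23) sinr_def)
    then show ?case
      using assms(4) by (simp add: assms(24) secrecy_capacity_pos_iff)
  qed
  then have ex: "P_ex = \<P>(\<omega> in M. \<gamma>_E \<omega> < \<gamma>_P \<omega>)"
    unfolding assms(25) by (intro prob_eq_AE) (auto simp: assms(24) secrecy_capacity_def)
  have "B0 > 0" "E0 > 0" "A0 > 0" "D0 > 0"
    using c0 d0 pos by (auto simp: assms(26-29))
  \<comment> \<open>\<open>C0\<close> is known only through its reciprocal, which is the merged rate
    \<open>l\<close> of the integral.\<close>
  then have l: "0 < 1 / C0"
    using assms(30) by (simp add: add_pos_pos)
  then have C0: "0 < C0" by simp
  have P: "P_ex = (LBINT x:{0..}. exp (- (1 / C0) * x) / (1 + A0 * x) *
      (1 / (E0 * (1 + D0 * x)) + D0 / (1 + D0 * x)\<^sup>2))"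
    unfolding ex assms(22,23)
    by (rule prob_sinr_less[OF X(1,2) i_P X(3,4) i_E i_PE[unfolded assms(22,23)]])
      (use pos c0 d0 assms(26-30) in auto)
  show ?thesis
  proof (intro conjI impI)
    assume "A0 = D0"
    then have eq: "P_ex =
        (1 - 1 / C0 / D0 * (exp (1 / C0 / D0) * inc_Gamma0 (1 / C0 / D0))) / (D0 * E0) +
        (1 - 1 / C0 / D0 + (1 / C0 / D0)\<^sup>2 * (exp (1 / C0 / D0) * inc_Gamma0 (1 / C0 / D0))) / 2"
      using P integral_exp_frac_equal[OF l \<open>D0 > 0\<close>, of E0] by (simp only:)
    \<comment> \<open>The \<open>Ei\<close> summand is the negative part of the first fraction in
      \<open>eq\<close>, as \<open>Ei (- z)\<close> is \<open>- inc_Gamma0 z\<close>.\<close>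
    show "P_ex = (C0 * D0 - 1) / (2 * C0 * D0) + 1 / (D0 * E0)
          + 1 / (2 * C0\<^sup>2 * D0\<^sup>2) * exp (1 / (C0 * D0)) * inc_Gamma0 (1 / (C0 * D0))
          + 1 / (C0 * D0\<^sup>2 * E0) * exp (1 / (C0 * D0)) * Ei (- (1 / (C0 * D0)))"
      unfolding eq using C0 \<open>D0 > 0\<close> \<open>E0 > 0\<close>
      by (simp add: Ei_def field_simps power2_eq_square)
  next
    assume "A0 \<noteq> D0"
    from integral_exp_frac_distinct[OF l \<open>A0 > 0\<close> \<open>D0 > 0\<close> this, of E0] P
    show "P_ex = A0 * D0 / (D0 - A0)\<^sup>2
            * (exp (1 / (A0 * C0)) * inc_Gamma0 (1 / (A0 * C0))
               - exp (1 / (C0 * D0)) * inc_Gamma0 (1 / (C0 * D0)))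
          + D0 / (D0 - A0)
          + 1 / (C0 * (D0 - A0)) * exp (1 / (C0 * D0)) * Ei (- (1 / (C0 * D0)))
          + 1 / (E0 * (A0 - D0))
            * (exp (1 / (A0 * C0)) * inc_Gamma0 (1 / (A0 * C0))
               - exp (1 / (C0 * D0)) * inc_Gamma0 (1 / (C0 * D0)))"
      by (simp add: Ei_def diff_divide_distrib mult.commute)
  qed (use ex in simp)
qed

end
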